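(* Let $G$ be a divisible nilpotent group. Then every (not necessarily finite) nonsingular system of equations over $G$ is solvable in $G$ itself.
   Context: Equations over groups. Let $G$ be a group and let $X=\{x_j\}_{j\in J}$ be a (possibly infinite) set of variables. Let $F(X)$ be the free group with basis $X$ and $G*F(X)$ the free product. An equation over $G$ is an expression $w=1$ with $w\in G*F(X)$ (each $w$ involves only finitely many variables). A system of equations over $G$ is a (finite or infinite) family $\{w_i=1\}_{i\in I}$ of such equations. The system is solvable in $G$ itself if there are elements $g_j\in G$ $(j\in J)$ such that substituting $g_j$ for $x_j$ makes all $w_i$ equal to $1$ in $G$; equivalently, there is a homomorphism $G*F(X)\to G$ which is the identity on $G$ and sends every $w_i$ to $1$. Exponent sums. For a system $\{w_i=1\}_{i\in I}$ let $a_{ij}\in\mathbb Z$ be the exponent sum of $x_j$ in $w_i$ (for example, the exponent sum of $x$ in $x^{-1}gyx^2g^2x^{-3}y^2$ is $-2$). The row of the $i$-th equation is $(a_{ij})_{j\in J}$; it has finitely many non-zero entries. The system is nonsingular if the family of rows, indexed by $i\in I$, is linearly independent over $\mathbb Q$ (equivalently, this holds for every finite subsystem). A group $G$ is divisible if for every prime $p$ (equivalently, for every integer $n\ge 1$ in place of $p$) every element of $G$ is a $p$-th power of some element of $G$. Torsion is allowed. *)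

theory Defs
  imports Complex_Main "HOL-Algebra.Generated_Groups" "HOL-Computational_Algebra.Primes"
begin

section \<open>Nilpotent and divisible groups\<close>

fun lower_central :: "('a, 'b) monoid_scheme \<Rightarrow> nat \<Rightarrow> 'a set" where
  "lower_central G 0 = carrier G"
| "lower_central G (Suc n) = generate G
     (\<Union>h \<in> lower_central G n. \<Union>g \<in> carrier G.
        {h \<otimes>\<^bsub>G\<^esub> g \<otimes>\<^bsub>G\<^esub> (inv\<^bsub>G\<^esub> h) \<otimes>\<^bsub>G\<^esub> (inv\<^bsub>G\<^esub> g)})"

definition nilpotent_group :: "('a, 'b) monoid_scheme \<Rightarrow> bool" where
  "nilpotent_group G \<longleftrightarrow> group G \<and> (\<exists>c. lower_central G c = {\<one>\<^bsub>G\<^esub>})"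

definition divisible_group :: "('a, 'b) monoid_scheme \<Rightarrow> bool" where
  "divisible_group G \<longleftrightarrow> group G \<and>
     (\<forall>p::nat. prime p \<longrightarrow> (\<forall>x \<in> carrier G. \<exists>y \<in> carrier G. y [^]\<^bsub>G\<^esub> p = x))"


section \<open>The free product of a group with a free group\<close>

datatype ('a, 'x) letter = Coeff 'a | Var 'x | VarInv 'x

definition free_words :: "('a, 'b) monoid_scheme \<Rightarrow> 'x set \<Rightarrow> ('a, 'x) letter list set" where
  "free_words G X = lists (Coeff ` carrier G \<union> Var ` X \<union> VarInv ` X)"

text \<open>The congruence on words generated by the multiplication table of \<open>G\<close> and the
  cancellation of variables; its quotient is \<open>G * F(X)\<close>.\<close>

inductive word_equiv ::
  "('a, 'b) monoid_scheme \<Rightarrow> 'x set \<Rightarrow> ('a, 'x) letter list \<Rightarrow> ('a, 'x) letter list \<Rightarrow> bool"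
  for G :: "('a, 'b) monoid_scheme" and X :: "'x set" where
  refl: "u \<in> free_words G X \<Longrightarrow> word_equiv G X u u"
| sym: "word_equiv G X u v \<Longrightarrow> word_equiv G X v u"
| trans: "word_equiv G X u v \<Longrightarrow> word_equiv G X v w \<Longrightarrow> word_equiv G X u w"
| append: "word_equiv G X u u' \<Longrightarrow> word_equiv G X v v' \<Longrightarrow> word_equiv G X (u @ v) (u' @ v')"
| coeff_one: "word_equiv G X [Coeff \<one>\<^bsub>G\<^esub>] []"
| coeff_mult: "g \<in> carrier G \<Longrightarrow> h \<in> carrier G \<Longrightarrow>
    word_equiv G X [Coeff g, Coeff h] [Coeff (g \<otimes>\<^bsub>G\<^esub> h)]"
| var_cancel: "x \<in> X \<Longrightarrow> word_equiv G X [Var x, VarInv x] []"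
| var_cancel': "x \<in> X \<Longrightarrow> word_equiv G X [VarInv x, Var x] []"

definition word_rel :: "('a, 'b) monoid_scheme \<Rightarrow> 'x set \<Rightarrow> ('a, 'x) letter list rel" where
  "word_rel G X = {(u, v). word_equiv G X u v}"

definition free_ext :: "('a, 'b) monoid_scheme \<Rightarrow> 'x set \<Rightarrow> ('a, 'x) letter list set monoid" where
  "free_ext G X = \<lparr>carrier = free_words G X // word_rel G X,
     monoid.mult = (\<lambda>A B. \<Union>u \<in> A. \<Union>v \<in> B. word_rel G X `` {u @ v}),
     one = word_rel G X `` {[]}\<rparr>"

definition ext_coeff ::
  "('a, 'b) monoid_scheme \<Rightarrow> 'x set \<Rightarrow> 'a \<Rightarrow> ('a, 'x) letter list set" where
  "ext_coeff G X g = word_rel G X `` {[Coeff g]}"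

definition ext_var ::
  "('a, 'b) monoid_scheme \<Rightarrow> 'x set \<Rightarrow> 'x \<Rightarrow> ('a, 'x) letter list set" where
  "ext_var G X x = word_rel G X `` {[Var x]}"


subsection \<open>Substitution and exponent sums\<close>

fun word_eval :: "('h, 'c) monoid_scheme \<Rightarrow> ('a \<Rightarrow> 'h) \<Rightarrow> ('x \<Rightarrow> 'h) \<Rightarrow> ('a, 'x) letter list \<Rightarrow> 'h" where
  "word_eval H \<phi> f [] = \<one>\<^bsub>H\<^esub>"
| "word_eval H \<phi> f (Coeff g # u) = \<phi> g \<otimes>\<^bsub>H\<^esub> word_eval H \<phi> f u"
| "word_eval H \<phi> f (Var x # u) = f x \<otimes>\<^bsub>H\<^esub> word_eval H \<phi> f u"
| "word_eval H \<phi> f (VarInv x # u) = (inv\<^bsub>H\<^esub> (f x)) \<otimes>\<^bsub>H\<^esub> word_eval H \<phi> f u"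

fun word_expsum :: "'x \<Rightarrow> ('a, 'x) letter list \<Rightarrow> int" where
  "word_expsum x [] = 0"
| "word_expsum x (Coeff g # u) = word_expsum x u"
| "word_expsum x (Var y # u) = (if y = x then 1 else 0) + word_expsum x u"
| "word_expsum x (VarInv y # u) = (if y = x then - 1 else 0) + word_expsum x u"

text \<open>Both functions are constant on equivalence classes, see \<open>word_equiv_eval\<close> and
  \<open>word_equiv_expsum\<close> below, so \<^const>\<open>the_elem\<close> picks their common value.\<close>

definition ext_lift ::
  "('h, 'c) monoid_scheme \<Rightarrow> ('a \<Rightarrow> 'h) \<Rightarrow> ('x \<Rightarrow> 'h) \<Rightarrow> ('a, 'x) letter list set \<Rightarrow> 'h" where
  "ext_lift H \<phi> f A = the_elem (word_eval H \<phi> f ` A)"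

definition substitute ::
  "('a, 'b) monoid_scheme \<Rightarrow> ('x \<Rightarrow> 'a) \<Rightarrow> ('a, 'x) letter list set \<Rightarrow> 'a" where
  "substitute G f A = ext_lift G (\<lambda>g. g) f A"

definition exponent_sum :: "'x \<Rightarrow> ('a, 'x) letter list set \<Rightarrow> int" where
  "exponent_sum x A = the_elem (word_expsum x ` A)"


section \<open>Systems of equations over a group\<close>

definition equation_system ::
  "('a, 'b) monoid_scheme \<Rightarrow> 'x set \<Rightarrow> 'i set \<Rightarrow> ('i \<Rightarrow> ('a, 'x) letter list set) \<Rightarrow> bool" where
  "equation_system G X I w \<longleftrightarrow> (\<forall>i \<in> I. w i \<in> carrier (free_ext G X))"

text \<open>Linear independence over the rationals of the rows, as a family indexed by \<open>I\<close>:
  two equal rows at different indices are dependent.\<close>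

definition nonsingular_system ::
  "'x set \<Rightarrow> 'i set \<Rightarrow> ('i \<Rightarrow> ('a, 'x) letter list set) \<Rightarrow> bool" where
  "nonsingular_system X I w \<longleftrightarrow>
     (\<forall>F (c :: 'i \<Rightarrow> rat). finite F \<and> F \<subseteq> I \<and>
        (\<forall>x \<in> X. (\<Sum>i \<in> F. c i * of_int (exponent_sum x (w i))) = 0) \<longrightarrow>
        (\<forall>i \<in> F. c i = 0))"

definition solvable_system ::
  "('a, 'b) monoid_scheme \<Rightarrow> 'x set \<Rightarrow> 'i set \<Rightarrow> ('i \<Rightarrow> ('a, 'x) letter list set) \<Rightarrow> bool" where
  "solvable_system G X I w \<longleftrightarrow>
     (\<exists>f \<in> X \<rightarrow> carrier G. \<forall>i \<in> I. substitute G f (w i) = \<one>\<^bsub>G\<^esub>)"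


section \<open>Well-definedness and the universal property\<close>

lemma free_words_Nil [simp]: "[] \<in> free_words G X"
  and free_words_append [simp]:
    "u @ v \<in> free_words G X \<longleftrightarrow> u \<in> free_words G X \<and> v \<in> free_words G X"
  and free_words_Coeff [simp]:
    "Coeff g # u \<in> free_words G X \<longleftrightarrow> g \<in> carrier G \<and> u \<in> free_words G X"
  and free_words_Var [simp]: "Var x # u \<in> free_words G X \<longleftrightarrow> x \<in> X \<and> u \<in> free_words G X"
  and free_words_VarInv [simp]: "VarInv x # u \<in> free_words G X \<longleftrightarrow> x \<in> X \<and> u \<in> free_words G X"
  by (auto simp: free_words_def)

lemma word_equiv_in:
  assumes "group G" "word_equiv G X u v"
  shows "u \<in> free_words G X \<and> v \<in> free_words G X"
  using assms(2) by induction (auto intro: group.is_monoid assms(1) monoid.m_closed)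

lemma equiv_word_rel: "group G \<Longrightarrow> equiv (free_words G X) (word_rel G X)"
  by (rule equivI)
    (auto simp: refl_on_def sym_def trans_def word_rel_def dest: word_equiv_in
      intro: word_equiv.refl word_equiv.sym word_equiv.trans)

lemma word_expsum_append [simp]: "word_expsum x (u @ v) = word_expsum x u + word_expsum x v"
  by (induction x u rule: word_expsum.induct) auto

lemma word_equiv_expsum: "word_equiv G X u v \<Longrightarrow> word_expsum x u = word_expsum x v"
  by (induction rule: word_equiv.induct) auto

lemma exponent_sum_class:
  assumes "u \<in> free_words G X"
  shows "exponent_sum x (word_rel G X `` {u}) = word_expsum x u"
  unfolding exponent_sum_def
  by (rule the_elem_image_unique)
    (use word_equiv.refl[OF assms] in \<open>auto simp: word_rel_def intro: word_equiv_expsum[OF word_equiv.sym]\<close>)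

context
  fixes G :: "('a, 'b) monoid_scheme" and X :: "'x set"
    and H :: "('h, 'c) monoid_scheme" and \<phi> :: "'a \<Rightarrow> 'h" and f :: "'x \<Rightarrow> 'h"
  assumes G: "group G" and H: "group H" and \<phi>: "\<phi> \<in> hom G H" and f: "f \<in> X \<rightarrow> carrier H"
begin

interpretation G: group G by (rule G)
interpretation H: group H by (rule H)

lemma hom_closed': "g \<in> carrier G \<Longrightarrow> \<phi> g \<in> carrier H"
  using \<phi> by (auto simp: hom_def)

lemma f_closed: "x \<in> X \<Longrightarrow> f x \<in> carrier H"
  using f by auto

lemma word_eval_closed: "u \<in> free_words G X \<Longrightarrow> word_eval H \<phi> f u \<in> carrier H"
proof (induction u)
  case (Cons a u)
  then show ?case by (cases a) (auto simp: hom_closed' f_closed)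
qed simp

lemma word_eval_append:
  "u \<in> free_words G X \<Longrightarrow> v \<in> free_words G X \<Longrightarrow>
     word_eval H \<phi> f (u @ v) = word_eval H \<phi> f u \<otimes>\<^bsub>H\<^esub> word_eval H \<phi> f v"
proof (induction u)
  case (Cons a u)
  then show ?case
    by (cases a) (auto simp: H.m_assoc word_eval_closed hom_closed' f_closed)
qed (simp add: word_eval_closed)

lemma word_equiv_eval: "word_equiv G X u v \<Longrightarrow> word_eval H \<phi> f u = word_eval H \<phi> f v"
proof (induction rule: word_equiv.induct)
  case (append u u' v v')
  then show ?case using word_equiv_in[OF G] by (metis word_eval_append)
next
  case coeff_one
  then show ?case using hom_one[OF \<phi> G H] by simp
next
  case (coeff_mult g h)
  then show ?case using \<phi> by (simp add: hom_closed' hom_mult)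
qed (auto simp: f_closed)

lemma ext_lift_class:
  assumes "u \<in> free_words G X"
  shows "ext_lift H \<phi> f (word_rel G X `` {u}) = word_eval H \<phi> f u"
  unfolding ext_lift_def
  by (rule the_elem_image_unique)
    (use word_equiv.refl[OF assms] in \<open>auto simp: word_rel_def intro: word_equiv_eval[OF word_equiv.sym]\<close>)

end

context
  fixes G :: "('a, 'b) monoid_scheme" and X :: "'x set"
  assumes G: "group G"
begin

interpretation G: group G by (rule G)

lemma class_eq_iff:
  "u \<in> free_words G X \<Longrightarrow> v \<in> free_words G X \<Longrightarrow>
     word_rel G X `` {u} = word_rel G X `` {v} \<longleftrightarrow> word_equiv G X u v"
  using eq_equiv_class_iff[OF equiv_word_rel[OF G]] by (auto simp: word_rel_def)

lemma free_ext_carrierE: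
  assumes "A \<in> carrier (free_ext G X)"
  obtains u where "u \<in> free_words G X" "A = word_rel G X `` {u}"
  using assms by (auto simp: free_ext_def elim: quotientE)

lemma class_in_free_ext: "u \<in> free_words G X \<Longrightarrow> word_rel G X `` {u} \<in> carrier (free_ext G X)"
  by (auto simp: free_ext_def intro: quotientI)

lemma free_ext_mult:
  assumes "u \<in> free_words G X" "v \<in> free_words G X"
  shows "word_rel G X `` {u} \<otimes>\<^bsub>free_ext G X\<^esub> word_rel G X `` {v} = word_rel G X `` {u @ v}"
proof -
  have "congruent2 (word_rel G X) (word_rel G X) (\<lambda>u v. word_rel G X `` {u @ v})"
    by (intro congruent2I'; rule equiv_class_eq[OF equiv_word_rel[OF G]])
      (simp add: word_rel_def word_equiv.append)
  then show ?thesis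
    using UN_equiv_class2[OF equiv_word_rel[OF G] equiv_word_rel[OF G]] assms
    by (simp add: free_ext_def)
qed

lemma free_ext_one: "\<one>\<^bsub>free_ext G X\<^esub> = word_rel G X `` {[]}"
  by (simp add: free_ext_def)

fun letter_inv :: "('a, 'x) letter \<Rightarrow> ('a, 'x) letter" where
  "letter_inv (Coeff g) = Coeff (inv\<^bsub>G\<^esub> g)"
| "letter_inv (Var x) = VarInv x"
| "letter_inv (VarInv x) = Var x"

lemma word_left_inverse:
  "u \<in> free_words G X \<Longrightarrow> \<exists>v \<in> free_words G X. word_equiv G X (v @ u) []"
proof (induction u)
  case Nil
  then show ?case by (intro bexI[of _ "[]"]) (auto intro: word_equiv.refl)
next
  case (Cons a u)
  then have u: "u \<in> free_words G X" and a: "[a] \<in> free_words G X"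
    using free_words_append[of "[a]" u G X] by auto
  then obtain v where v: "v \<in> free_words G X" "word_equiv G X (v @ u) []" using Cons by auto
  have b: "[letter_inv a] \<in> free_words G X" "word_equiv G X ([letter_inv a] @ [a]) []"
  proof (atomize(full), cases a)
    case (Coeff g)
    then have g: "g \<in> carrier G" using a by simp
    have "word_equiv G X [Coeff (inv\<^bsub>G\<^esub> g), Coeff g] [Coeff \<one>\<^bsub>G\<^esub>]"
      using word_equiv.coeff_mult[of "inv\<^bsub>G\<^esub> g" G g X] g by simp
    then show "[letter_inv a] \<in> free_words G X \<and> word_equiv G X ([letter_inv a] @ [a]) []"
      using Coeff g word_equiv.coeff_one word_equiv.trans by fastforce
  qed (use a in \<open>auto intro: word_equiv.intros\<close>)
  have "word_equiv G X (([letter_inv a] @ [a]) @ u) ([] @ u)"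
    by (rule word_equiv.append[OF b(2) word_equiv.refl[OF u]])
  with word_equiv.refl[OF v(1)]
  have "word_equiv G X (v @ (([letter_inv a] @ [a]) @ u)) (v @ ([] @ u))"
    by (rule word_equiv.append)
  then have "word_equiv G X ((v @ [letter_inv a]) @ a # u) []"
    using v(2) word_equiv.trans by fastforce
  then show ?case using v b(1) by (intro bexI[of _ "v @ [letter_inv a]"]) auto
qed

lemma group_free_ext: "group (free_ext G X)"
proof (rule groupI)
  fix A B assume "A \<in> carrier (free_ext G X)" "B \<in> carrier (free_ext G X)"
  then show "A \<otimes>\<^bsub>free_ext G X\<^esub> B \<in> carrier (free_ext G X)"
    by (elim free_ext_carrierE) (simp add: free_ext_mult class_in_free_ext)
next
  fix A B C
  assume "A \<in> carrier (free_ext G X)" "B \<in> carrier (free_ext G X)" "C \<in> carrier (free_ext G X)"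
  then show "A \<otimes>\<^bsub>free_ext G X\<^esub> B \<otimes>\<^bsub>free_ext G X\<^esub> C
      = A \<otimes>\<^bsub>free_ext G X\<^esub> (B \<otimes>\<^bsub>free_ext G X\<^esub> C)"
    by (elim free_ext_carrierE) (simp add: free_ext_mult)
next
  fix A assume "A \<in> carrier (free_ext G X)"
  then show "\<one>\<^bsub>free_ext G X\<^esub> \<otimes>\<^bsub>free_ext G X\<^esub> A = A"
    by (elim free_ext_carrierE) (simp add: free_ext_mult free_ext_one)
next
  fix A assume "A \<in> carrier (free_ext G X)"
  then obtain u where u: "u \<in> free_words G X" "A = word_rel G X `` {u}"
    by (rule free_ext_carrierE)
  obtain v where v: "v \<in> free_words G X" "word_equiv G X (v @ u) []"
    using word_left_inverse[OF u(1)] by auto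
  show "\<exists>B \<in> carrier (free_ext G X). B \<otimes>\<^bsub>free_ext G X\<^esub> A = \<one>\<^bsub>free_ext G X\<^esub>"
    using u v by (intro bexI[of _ "word_rel G X `` {v}"])
      (simp_all add: free_ext_mult free_ext_one class_in_free_ext class_eq_iff)
qed (simp add: free_ext_one class_in_free_ext)

lemma ext_coeff_hom: "ext_coeff G X \<in> hom G (free_ext G X)"
  by (rule homI) (simp_all add: ext_coeff_def class_in_free_ext free_ext_mult class_eq_iff
      word_equiv.coeff_mult word_equiv.sym)

lemma ext_var_closed: "x \<in> X \<Longrightarrow> ext_var G X x \<in> carrier (free_ext G X)"
  by (simp add: ext_var_def class_in_free_ext)

text \<open>The universal property of the coproduct of \<open>G\<close> and the free group on \<open>X\<close>.\<close>

lemma ext_lift_hom: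
  assumes H: "group H" and \<phi>: "\<phi> \<in> hom G H" and f: "f \<in> X \<rightarrow> carrier H"
  shows "ext_lift H \<phi> f \<in> hom (free_ext G X) H"
    and "\<And>g. g \<in> carrier G \<Longrightarrow> ext_lift H \<phi> f (ext_coeff G X g) = \<phi> g"
    and "\<And>x. x \<in> X \<Longrightarrow> ext_lift H \<phi> f (ext_var G X x) = f x"
proof -
  interpret H: group H by (rule H)
  note lift = ext_lift_class[OF G H \<phi> f]
  show "ext_lift H \<phi> f \<in> hom (free_ext G X) H"
    by (rule homI; elim free_ext_carrierE)
      (simp_all add: lift free_ext_mult word_eval_closed[OF G H \<phi> f] word_eval_append[OF G H \<phi> f])
  show "\<And>g. g \<in> carrier G \<Longrightarrow> ext_lift H \<phi> f (ext_coeff G X g) = \<phi> g"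
    using \<phi> by (simp add: ext_coeff_def lift hom_in_carrier)
  show "\<And>x. x \<in> X \<Longrightarrow> ext_lift H \<phi> f (ext_var G X x) = f x"
    using f by (simp add: ext_var_def lift Pi_iff)
qed

lemma ext_lift_unique:
  assumes H: "group H" and \<phi>: "\<phi> \<in> hom G H" and f: "f \<in> X \<rightarrow> carrier H"
    and \<psi>: "\<psi> \<in> hom (free_ext G X) H"
    and coeff: "\<And>g. g \<in> carrier G \<Longrightarrow> \<psi> (ext_coeff G X g) = \<phi> g"
    and var: "\<And>x. x \<in> X \<Longrightarrow> \<psi> (ext_var G X x) = f x"
    and A: "A \<in> carrier (free_ext G X)"
  shows "\<psi> A = ext_lift H \<phi> f A"
proof -
  interpret H: group H by (rule H)
  interpret E: group "free_ext G X" by (rule group_free_ext)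
  interpret \<psi>: group_hom "free_ext G X" H \<psi> by unfold_locales (rule \<psi>)
  have letter: "\<psi> (word_rel G X `` {[a]}) = word_eval H \<phi> f [a]" if "[a] \<in> free_words G X" for a
  proof (cases a)
    case (Coeff g)
    then show ?thesis using that coeff[of g] \<phi> by (simp add: ext_coeff_def hom_in_carrier)
  next
    case (Var x)
    then show ?thesis using that var[of x] f by (simp add: ext_var_def Pi_iff)
  next
    case (VarInv x)
    then have x: "x \<in> X" using that by simp
    have "word_rel G X `` {[VarInv x]} \<otimes>\<^bsub>free_ext G X\<^esub> ext_var G X x = \<one>\<^bsub>free_ext G X\<^esub>"
      using x by (simp add: ext_var_def free_ext_mult free_ext_one class_eq_iff
          word_equiv.var_cancel')
    then have "inv\<^bsub>free_ext G X\<^esub> ext_var G X x = word_rel G X `` {[VarInv x]}"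
      using x by (intro E.inv_equality) (simp_all add: ext_var_closed class_in_free_ext)
    then have "\<psi> (word_rel G X `` {[VarInv x]}) = inv\<^bsub>H\<^esub> f x"
      using \<psi>.hom_inv[OF ext_var_closed[OF x]] var[OF x] by simp
    then show ?thesis using VarInv x f by (simp add: Pi_iff)
  qed
  have "\<psi> (word_rel G X `` {u}) = word_eval H \<phi> f u" if "u \<in> free_words G X" for u
    using that
  proof (induction u)
    case Nil
    then show ?case using \<psi>.hom_one by (simp add: free_ext_one)
  next
    case (Cons a u)
    then have a: "[a] \<in> free_words G X" and u: "u \<in> free_words G X"
      using free_words_append[of "[a]" u G X] by auto
    have "\<psi> (word_rel G X `` {a # u})
        = \<psi> (word_rel G X `` {[a]}) \<otimes>\<^bsub>H\<^esub> \<psi> (word_rel G X `` {u})"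
      using free_ext_mult[OF a u] \<psi>.hom_mult[OF class_in_free_ext[OF a] class_in_free_ext[OF u]]
      by simp
    also have "\<dots> = word_eval H \<phi> f (a # u)"
      using word_eval_append[OF G H \<phi> f a u] Cons.IH[OF u] letter[OF a] by simp
    finally show ?case .
  qed
  then show ?thesis using A ext_lift_class[OF G H \<phi> f] by (elim free_ext_carrierE) simp
qed

lemma solvable_system_iff_hom:
  assumes w: "equation_system G X I w"
  shows "solvable_system G X I w \<longleftrightarrow>
    (\<exists>\<psi> \<in> hom (free_ext G X) G.
       (\<forall>g \<in> carrier G. \<psi> (ext_coeff G X g) = g) \<and> (\<forall>i \<in> I. \<psi> (w i) = \<one>\<^bsub>G\<^esub>))"
    (is "_ \<longleftrightarrow> (\<exists>\<psi> \<in> _. ?P \<psi>)")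
proof
  have id: "(\<lambda>g. g) \<in> hom G G" by (rule homI) simp_all
  {
    assume "solvable_system G X I w"
    then obtain f where f: "f \<in> X \<rightarrow> carrier G" "\<forall>i \<in> I. substitute G f (w i) = \<one>\<^bsub>G\<^esub>"
      by (auto simp: solvable_system_def)
    then show "\<exists>\<psi> \<in> hom (free_ext G X) G. ?P \<psi>"
      using ext_lift_hom[OF G id f(1)]
      by (intro bexI[of _ "ext_lift G (\<lambda>g. g) f"]) (auto simp: substitute_def)
  next
    assume "\<exists>\<psi> \<in> hom (free_ext G X) G. ?P \<psi>"
    then obtain \<psi> where \<psi>: "\<psi> \<in> hom (free_ext G X) G" "?P \<psi>" by auto
    let ?f = "\<lambda>x. \<psi> (ext_var G X x)"
    have f: "?f \<in> X \<rightarrow> carrier G" using \<psi>(1) ext_var_closed by (auto simp: hom_def)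
    have "substitute G ?f (w i) = \<one>\<^bsub>G\<^esub>" if "i \<in> I" for i
      using ext_lift_unique[OF G id f \<psi>(1), of "w i"] \<psi>(2) w that
      by (simp add: substitute_def equation_system_def)
    then show "solvable_system G X I w" using f by (auto simp: solvable_system_def)
  }
qed

end

end

theory Submission
  imports Defs "HOL-Algebra.Free_Abelian_Groups"
begin

text \<open>
  The solution is built along the lower central series \<open>G = \<gamma>\<^sub>0 \<ge> \<gamma>\<^sub>1 \<ge> \<dots> \<ge> \<gamma>\<^sub>c = 1\<close>: if a substitution
  \<open>f\<close> sends every \<open>w\<^sub>i\<close> into \<open>\<gamma>\<^sub>k\<close>, it can be corrected so that every \<open>w\<^sub>i\<close> goes to \<open>\<gamma>\<^sub>k\<^sub>+\<^sub>1\<close>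
  (\<open>solvable_modulo_lower_central\<close>). The correction takes place in \<open>Q = G / \<gamma>\<^sub>k\<^sub>+\<^sub>1\<close>, where the image \<open>A\<close>
  of \<open>\<gamma>\<^sub>k\<close> is central. Multiplying \<open>f\<close> by a family \<open>z\<close> of elements of \<open>A\<close> multiplies the value of \<open>w\<^sub>i\<close>
  by \<open>\<Prod>\<^sub>x z\<^sub>x\<^sup>a\<close>, where \<open>a\<close> is the exponent sum of \<open>x\<close> in \<open>w\<^sub>i\<close> (\<open>word_eval_central_shift\<close>).
  So the unknown family \<open>z\<close> has to solve an ordinary linear system over the abelian group \<open>A\<close>, and
  the coefficients of the \<open>w\<^sub>i\<close> only enter through its right-hand side.

  This linear system is solvable because \<open>A\<close> is divisible, hence injective as an abelian group.
  Linear independence of the rows means that the map from the free abelian group on the equations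
  to the free abelian group on the variables, taking an equation to its row, is injective. The
  prescribed right-hand sides define a homomorphism from the former group to \<open>A\<close>; its extension to
  the latter evaluates at the variables to a solution (\<open>divisible_linear_system\<close>). As the
  extension comes from Zorn's lemma, neither the equations nor the variables need be finite in
  number.

  Divisibility of \<open>A\<close> is inherited from \<open>G\<close>, even though \<open>\<gamma>\<^sub>k\<close> is given only by generators:
  for \<open>k > 0\<close>, modulo \<open>\<gamma>\<^sub>k\<^sub>+\<^sub>1\<close> a commutator \<open>[h, g]\<close> with \<open>h \<in> \<gamma>\<^sub>k\<^sub>-\<^sub>1\<close> is multiplicative in \<open>g\<close>, so \<open>g = g'\<^sup>n\<close> gives
  \<open>[h, g] = [h, g']\<^sup>n\<close> (\<open>lower_central_quotient_divisible\<close>).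
\<close>

section \<open>Injectivity of divisible abelian groups\<close>

lemma divisible_group_root:
  fixes n :: nat
  assumes "divisible_group A" "x \<in> carrier A" "n > 0"
  obtains y where "y \<in> carrier A" "y [^]\<^bsub>A\<^esub> n = x"
proof -
  interpret group A using assms(1) by (simp add: divisible_group_def)
  have "\<exists>y \<in> carrier A. y [^]\<^bsub>A\<^esub> n = x"
    using assms(2,3)
  proof (induction n arbitrary: x rule: less_induct)
    case (less n)
    show ?case
    proof (cases "n = 1")
      case True
      then show ?thesis using less.prems by (intro bexI[of _ x]) auto
    next
      case False
      then obtain p where p: "prime p" "p dvd n" by (meson prime_factor_nat)
      then obtain m where m: "n = p * m" by (elim dvdE)
      obtain z where z: "z \<in> carrier A" "z [^]\<^bsub>A\<^esub> p = x"
        using assms(1) p less.prems unfolding divisible_group_def by blast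
      have "m < n" "m > 0" using m less.prems prime_gt_1_nat[OF p(1)] by auto
      then obtain y where "y \<in> carrier A" "y [^]\<^bsub>A\<^esub> m = z" using less.IH z(1) by blast
      then show ?thesis
        using z m by (intro bexI[of _ y]) (auto simp: nat_pow_pow mult.commute)
    qed
  qed
  then show ?thesis using that by blast
qed

lemma DirProd_int_pow:
  assumes "group M" "group A" "x \<in> carrier M" "a \<in> carrier A"
  shows "(x, a) [^]\<^bsub>M \<times>\<times> A\<^esub> (n::int) = (x [^]\<^bsub>M\<^esub> n, a [^]\<^bsub>A\<^esub> n)"
proof -
  have D: "group (M \<times>\<times> A)" using assms by (simp add: DirProd_group)
  have "fst \<in> hom (M \<times>\<times> A) M" "snd \<in> hom (M \<times>\<times> A) A"
    by (auto simp: hom_def mult_DirProd')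
  from this[THEN hom_int_pow[OF _ _ D]] assms show ?thesis
    by (metis SigmaI carrier_DirProd fst_conv prod.collapse snd_conv)
qed

lemma comm_group_DirProd: "comm_group M \<Longrightarrow> comm_group A \<Longrightarrow> comm_group (M \<times>\<times> A)"
  by (intro group.group_comm_groupI DirProd_group)
    (auto simp: comm_group_def comm_monoid.m_comm)

text \<open>The graph of a homomorphism into \<open>A\<close> from some subgroup of \<open>M\<close>. Graphs rather than functions
  make the extension order plain inclusion and the union of a chain an upper bound. As \<open>\<Gamma>\<close> is a
  subgroup, single-valuedness need only be required at the unit.\<close>

definition partial_hom :: "('m, 'c) monoid_scheme \<Rightarrow> ('a, 'd) monoid_scheme \<Rightarrow> ('m \<times> 'a) set \<Rightarrow> bool" where
  "partial_hom M A \<Gamma> \<longleftrightarrow> subgroup \<Gamma> (M \<times>\<times> A) \<and> (\<forall>a. (\<one>\<^bsub>M\<^esub>, a) \<in> \<Gamma> \<longrightarrow> a = \<one>\<^bsub>A\<^esub>)"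

lemma partial_hom_pow:
  assumes "group M" "group A" "partial_hom M A \<Gamma>" "(x, a) \<in> \<Gamma>"
  shows "(x [^]\<^bsub>M\<^esub> (n::int), a [^]\<^bsub>A\<^esub> n) \<in> \<Gamma>"
proof -
  have D: "group (M \<times>\<times> A)" using assms by (simp add: DirProd_group)
  have s: "subgroup \<Gamma> (M \<times>\<times> A)" using assms(3) by (simp add: partial_hom_def)
  have c: "x \<in> carrier M" "a \<in> carrier A" using subgroup.mem_carrier[OF s assms(4)] by auto
  show ?thesis
    using group.int_pow_consistent[OF D s assms(4), of n]
      group.int_pow_closed[OF subgroup.subgroup_is_group[OF s D], of "(x,a)" n] assms(4)
    by (simp add: DirProd_int_pow[OF assms(1,2) c])
qed

lemma partial_hom_mult:
  "\<lbrakk>partial_hom M A \<Gamma>; (x, a) \<in> \<Gamma>; (y, b) \<in> \<Gamma>\<rbrakk> \<Longrightarrow> (x \<otimes>\<^bsub>M\<^esub> y, a \<otimes>\<^bsub>A\<^esub> b) \<in> \<Gamma>"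
  using subgroup.m_closed[of \<Gamma> "M \<times>\<times> A"] by (force simp: partial_hom_def)

lemma partial_hom_unique:
  assumes "group M" "group A" "partial_hom M A \<Gamma>" "(x, a) \<in> \<Gamma>" "(x, b) \<in> \<Gamma>"
  shows "a = b"
proof -
  interpret M: group M by fact
  interpret A: group A by fact
  have c: "x \<in> carrier M" "a \<in> carrier A" "b \<in> carrier A"
    using assms(3-5) subgroup.mem_carrier[of \<Gamma> "M \<times>\<times> A"] by (auto simp: partial_hom_def)
  have "(x [^]\<^bsub>M\<^esub> (-1::int), b [^]\<^bsub>A\<^esub> (-1::int)) \<in> \<Gamma>"
    by (rule partial_hom_pow[OF assms(1-3,5)])
  then have "(inv\<^bsub>M\<^esub> x, inv\<^bsub>A\<^esub> b) \<in> \<Gamma>"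
    using c by (simp add: M.int_pow_neg A.int_pow_neg)
  note partial_hom_mult[OF assms(3,4) this]
  then have "a \<otimes>\<^bsub>A\<^esub> inv\<^bsub>A\<^esub> b = \<one>\<^bsub>A\<^esub>"
    using assms(3) c by (simp add: partial_hom_def)
  then show ?thesis using c by (metis A.inv_closed A.inv_equality A.inv_inv)
qed

text \<open>The value at a new point \<open>x\<close> must agree with \<open>\<Gamma>\<close> on all powers of \<open>x\<close> in its domain. Those
  powers are the multiples of the least positive exponent \<open>d\<close> that occurs, so a \<open>d\<close>-th root of
  the value at \<open>x\<^sup>d\<close> does the job; if no positive exponent occurs, any value does.\<close>

lemma divisible_group_prescribed_powers:
  assumes "comm_group M" "comm_group A" "divisible_group A" "partial_hom M A \<Gamma>" "x \<in> carrier M"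
  obtains a where "a \<in> carrier A" "\<And>(n::int) c. (x [^]\<^bsub>M\<^esub> n, c) \<in> \<Gamma> \<Longrightarrow> c = a [^]\<^bsub>A\<^esub> n"
proof -
  interpret M: comm_group M by fact
  interpret A: comm_group A by fact
  note gr = M.is_group A.is_group
  have car: "c \<in> carrier A" if "(y, c) \<in> \<Gamma>" for y c
    using that assms(4) subgroup.mem_carrier[of \<Gamma> "M \<times>\<times> A"] by (auto simp: partial_hom_def)
  define D where "D n \<longleftrightarrow> n > 0 \<and> (\<exists>c. (x [^]\<^bsub>M\<^esub> int n, c) \<in> \<Gamma>)" for n :: nat
  show thesis
  proof (cases "\<exists>n. D n")
    case True
    define d where "d = (LEAST n. D n)"
    have d: "D d" using True LeastI_ex unfolding d_def by metis
    then obtain c where c: "(x [^]\<^bsub>M\<^esub> int d, c) \<in> \<Gamma>" and d0: "d > 0" by (auto simp: D_def)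
    obtain a where a: "a \<in> carrier A" "a [^]\<^bsub>A\<^esub> d = c"
      using divisible_group_root[OF assms(3) car[OF c] d0] by blast
    show thesis
    proof (rule that[OF a(1)])
      fix n :: int and e assume e: "(x [^]\<^bsub>M\<^esub> n, e) \<in> \<Gamma>"
      \<comment> \<open>Dividing by the \<open>q\<close>-th power of \<open>(x\<^sup>d, c)\<close> leaves an exponent \<open>r < d\<close>, so \<open>r = 0\<close> by minimality.\<close>
      define q r where "q = n div int d" and "r = n mod int d"
      have qr: "n = int d * q + r" "0 \<le> r" "r < int d" using d0 by (auto simp: q_def r_def)
      have cq: "(x [^]\<^bsub>M\<^esub> (int d * q), c [^]\<^bsub>A\<^esub> q) \<in> \<Gamma>" for q
        using partial_hom_pow[OF gr assms(4) c, of q] assms(5) by (simp add: M.int_pow_pow)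
      have "(x [^]\<^bsub>M\<^esub> (n + int d * (- q)), e \<otimes>\<^bsub>A\<^esub> c [^]\<^bsub>A\<^esub> (- q)) \<in> \<Gamma>"
        using partial_hom_mult[OF assms(4) e cq, of "- q"] assms(5) by (simp only: M.int_pow_mult)
      then have "(x [^]\<^bsub>M\<^esub> int (nat r), e \<otimes>\<^bsub>A\<^esub> c [^]\<^bsub>A\<^esub> (- q)) \<in> \<Gamma>"
        using qr by simp
      moreover have "\<not> D (nat r)"
        using not_less_Least[of "nat r" D] qr unfolding d_def[symmetric] by linarith
      ultimately have "n = int d * q" using qr by (auto simp: D_def)
      then have "e = c [^]\<^bsub>A\<^esub> q"
        using partial_hom_unique[OF gr assms(4) e] cq[of q] by simp
      also have "\<dots> = a [^]\<^bsub>A\<^esub> n"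
        using a \<open>n = int d * q\<close> by (metis A.int_pow_pow int_pow_int)
      finally show "e = a [^]\<^bsub>A\<^esub> n" .
    qed
  next
    case False
    show thesis
    proof (rule that[OF A.one_closed])
      fix n :: int and e assume e: "(x [^]\<^bsub>M\<^esub> n, e) \<in> \<Gamma>"
      have "(x [^]\<^bsub>M\<^esub> (- n), e [^]\<^bsub>A\<^esub> (- 1::int)) \<in> \<Gamma>"
        using partial_hom_pow[OF gr assms(4) e, of "- 1"] assms(5) by (simp add: M.int_pow_pow)
      moreover have "(x [^]\<^bsub>M\<^esub> n', c) \<notin> \<Gamma>" if "n' > 0" for n' :: int and c
        using False that by (auto simp: D_def dest: spec[of _ "nat n'"])
      ultimately have "n = 0" using e by (metis neg_0_less_iff_less linorder_neqE)
      then have "e = \<one>\<^bsub>A\<^esub>" using e assms(4) by (simp add: partial_hom_def)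
      then show "e = \<one>\<^bsub>A\<^esub> [^]\<^bsub>A\<^esub> n" by simp
    qed
  qed
qed

lemma partial_hom_extend:
  assumes "comm_group M" "comm_group A" "divisible_group A" "partial_hom M A \<Gamma>" "x \<in> carrier M"
  obtains \<Gamma>' a where "partial_hom M A \<Gamma>'" "\<Gamma> \<subseteq> \<Gamma>'" "(x, a) \<in> \<Gamma>'"
proof -
  interpret M: comm_group M by fact
  interpret A: comm_group A by fact
  interpret D: comm_group "M \<times>\<times> A" by (rule comm_group_DirProd) fact+
  note gr = M.is_group A.is_group
  have s: "subgroup \<Gamma> (M \<times>\<times> A)" using assms(4) by (simp add: partial_hom_def)
  obtain a where a: "a \<in> carrier A" "\<And>(n::int) c. (x [^]\<^bsub>M\<^esub> n, c) \<in> \<Gamma> \<Longrightarrow> c = a [^]\<^bsub>A\<^esub> n"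
    using divisible_group_prescribed_powers[OF assms] by metis
  have xa: "(x, a) \<in> carrier (M \<times>\<times> A)" using a assms(5) by simp
  \<comment> \<open>The compatibility of \<open>a\<close> with \<open>\<Gamma>\<close> is what keeps the product single-valued.\<close>
  define \<Gamma>' where "\<Gamma>' = \<Gamma> <#>\<^bsub>M \<times>\<times> A\<^esub> generate (M \<times>\<times> A) {(x, a)}"
  have mem: "z \<in> \<Gamma>' \<longleftrightarrow> (\<exists>m b n. (m, b) \<in> \<Gamma> \<and> z = (m \<otimes>\<^bsub>M\<^esub> x [^]\<^bsub>M\<^esub> (n::int), b \<otimes>\<^bsub>A\<^esub> a [^]\<^bsub>A\<^esub> n))" for z
  proof -
    have "z \<in> \<Gamma>' \<longleftrightarrow> (\<exists>g\<in>\<Gamma>. \<exists>n::int. z = g \<otimes>\<^bsub>M \<times>\<times> A\<^esub> (x [^]\<^bsub>M\<^esub> n, a [^]\<^bsub>A\<^esub> n))"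
      unfolding \<Gamma>'_def set_mult_def D.generate_pow[OF xa]
      by (auto simp: DirProd_int_pow[OF gr assms(5) a(1)])
    then show ?thesis by (auto simp: Bex_def)
  qed
  have "partial_hom M A \<Gamma>'"
    unfolding partial_hom_def
  proof (intro conjI allI impI)
    show "subgroup \<Gamma>' (M \<times>\<times> A)"
      unfolding \<Gamma>'_def using s xa by (intro D.mult_subgroups D.generate_is_subgroup) auto
    fix e assume "(\<one>\<^bsub>M\<^esub>, e) \<in> \<Gamma>'"
    then obtain m b and n :: int where mb: "(m, b) \<in> \<Gamma>"
      and eq: "\<one>\<^bsub>M\<^esub> = m \<otimes>\<^bsub>M\<^esub> x [^]\<^bsub>M\<^esub> n" "e = b \<otimes>\<^bsub>A\<^esub> a [^]\<^bsub>A\<^esub> n"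
      by (auto simp: mem)
    have c: "m \<in> carrier M" "b \<in> carrier A" using subgroup.mem_carrier[OF s mb] by auto
    have "m = inv\<^bsub>M\<^esub> (x [^]\<^bsub>M\<^esub> n)"
      using eq(1) c assms(5) by (metis M.int_pow_closed M.inv_equality)
    then have "m = x [^]\<^bsub>M\<^esub> (- n)" using assms(5) by (simp add: M.int_pow_neg)
    then have "b = a [^]\<^bsub>A\<^esub> (- n)" using mb a(2) by simp
    then show "e = \<one>\<^bsub>A\<^esub>" using eq(2) a(1) by (simp add: A.int_pow_neg)
  qed
  moreover have "\<Gamma> \<subseteq> \<Gamma>'"
  proof
    fix z assume z: "z \<in> \<Gamma>"
    then obtain m b where mb: "z = (m, b)" "m \<in> carrier M" "b \<in> carrier A"
      using subgroup.mem_carrier[OF s] by (cases z) auto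
    then show "z \<in> \<Gamma>'"
      using z unfolding mem by (intro exI[of _ m] exI[of _ b] exI[of _ "0::int"]) simp
  qed
  moreover have "(x, a) \<in> \<Gamma>'"
    using subgroup.one_closed[OF s] a assms(5) unfolding mem
    by (intro exI[of _ "\<one>\<^bsub>M\<^esub>"] exI[of _ "\<one>\<^bsub>A\<^esub>"] exI[of _ "1::int"]) simp
  ultimately show thesis using that by blast
qed

lemma partial_hom_Union_chain:
  assumes "group M" "group A" "\<C> \<noteq> {}" "subset.chain {\<Gamma>. partial_hom M A \<Gamma>} \<C>"
  shows "partial_hom M A (\<Union>\<C>)"
proof -
  have s: "subgroup \<Gamma> (M \<times>\<times> A)" and p: "partial_hom M A \<Gamma>" if "\<Gamma> \<in> \<C>" for \<Gamma>
    using assms(4) that by (auto simp: subset_chain_def partial_hom_def)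
  have "subgroup (\<Union>\<C>) (M \<times>\<times> A)"
  proof (rule group.subgroupI[OF DirProd_group[OF assms(1,2)]])
    show "\<Union>\<C> \<subseteq> carrier (M \<times>\<times> A)" using subgroup.subset[OF s] by blast
    show "\<Union>\<C> \<noteq> {}" using assms(3) subgroup.one_closed[OF s] by blast
    fix y assume y: "y \<in> \<Union>\<C>"
    then show "inv\<^bsub>M \<times>\<times> A\<^esub> y \<in> \<Union>\<C>" using subgroup.m_inv_closed[OF s] by blast
    fix z assume "z \<in> \<Union>\<C>"
    then obtain \<Gamma> where "\<Gamma> \<in> \<C>" "y \<in> \<Gamma>" "z \<in> \<Gamma>"
      using y assms(4) unfolding subset_chain_def by blast
    then show "y \<otimes>\<^bsub>M \<times>\<times> A\<^esub> z \<in> \<Union>\<C>" using subgroup.m_closed[OF s] by blast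
  qed
  then show ?thesis using p by (auto simp: partial_hom_def)
qed

text \<open>By \<open>partial_hom_extend\<close>, a maximal graph containing that of \<open>\<beta> \<circ> \<phi>\<^sup>-\<^sup>1\<close> is defined on all of
  \<open>M\<close>.\<close>

theorem divisible_group_injective:
  assumes "comm_group K" "comm_group M" "comm_group A" "divisible_group A"
    and \<phi>: "\<phi> \<in> hom K M" "inj_on \<phi> (carrier K)" and \<beta>: "\<beta> \<in> hom K A"
  obtains h where "h \<in> hom M A" "\<And>k. k \<in> carrier K \<Longrightarrow> h (\<phi> k) = \<beta> k"
proof -
  interpret K: comm_group K by fact
  interpret M: comm_group M by fact
  interpret A: comm_group A by fact
  note gr = M.is_group A.is_group
  define \<Gamma>\<^sub>0 where "\<Gamma>\<^sub>0 = (\<lambda>k. (\<phi> k, \<beta> k)) ` carrier K"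
  have "(\<lambda>k. (\<phi> k, \<beta> k)) \<in> hom K (M \<times>\<times> A)" using \<phi> \<beta> by (simp add: hom_paired)
  then have "subgroup \<Gamma>\<^sub>0 (M \<times>\<times> A)"
    unfolding \<Gamma>\<^sub>0_def
    by (intro group_hom.img_is_subgroup) (simp add: group_hom_def group_hom_axioms_def DirProd_group)
  moreover have "a = \<one>\<^bsub>A\<^esub>" if one: "(\<one>\<^bsub>M\<^esub>, a) \<in> \<Gamma>\<^sub>0" for a
  proof -
    obtain k where k: "k \<in> carrier K" "\<phi> k = \<one>\<^bsub>M\<^esub>" "a = \<beta> k" using one by (auto simp: \<Gamma>\<^sub>0_def)
    then have "k = \<one>\<^bsub>K\<^esub>"
      using \<phi>(2) hom_one[OF \<phi>(1) K.is_group gr(1)] by (metis inj_onD K.one_closed)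
    then show ?thesis using k(3) hom_one[OF \<beta> K.is_group gr(2)] by simp
  qed
  ultimately have \<Gamma>\<^sub>0: "partial_hom M A \<Gamma>\<^sub>0" by (simp add: partial_hom_def)
  let ?E = "{\<Gamma>. partial_hom M A \<Gamma> \<and> \<Gamma>\<^sub>0 \<subseteq> \<Gamma>}"
  have "\<exists>\<Gamma>\<in>?E. \<forall>\<Delta>\<in>?E. \<Gamma> \<subseteq> \<Delta> \<longrightarrow> \<Delta> = \<Gamma>"
  proof (rule subset_Zorn_nonempty)
    show "?E \<noteq> {}" using \<Gamma>\<^sub>0 by blast
    fix \<C> assume ne: "\<C> \<noteq> {}" and C: "subset.chain ?E \<C>"
    then have "subset.chain {\<Gamma>. partial_hom M A \<Gamma>} \<C>"
      by (auto simp: subset_chain_def)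
    then have "partial_hom M A (\<Union>\<C>)" by (rule partial_hom_Union_chain[OF gr ne])
    moreover have "\<Gamma>\<^sub>0 \<subseteq> \<Union>\<C>" using ne C unfolding subset_chain_def by fast
    ultimately show "\<Union>\<C> \<in> ?E" by blast
  qed
  then obtain \<Gamma> where "\<Gamma> \<in> ?E" and maxE: "\<forall>\<Delta>\<in>?E. \<Gamma> \<subseteq> \<Delta> \<longrightarrow> \<Delta> = \<Gamma>" ..
  then have \<Gamma>: "partial_hom M A \<Gamma>" "\<Gamma>\<^sub>0 \<subseteq> \<Gamma>" by simp_all
  have max: "\<Delta> = \<Gamma>" if "partial_hom M A \<Delta>" "\<Gamma> \<subseteq> \<Delta>" for \<Delta>
    using maxE that \<Gamma>(2) by simp
  have total: "\<exists>a. (x, a) \<in> \<Gamma>" if "x \<in> carrier M" for x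
    using partial_hom_extend[OF assms(2-4) \<Gamma>(1) that] max by metis
  define h where "h x = (SOME a. (x, a) \<in> \<Gamma>)" for x
  have h: "(x, h x) \<in> \<Gamma>" if "x \<in> carrier M" for x
    using someI_ex[OF total[OF that]] by (simp add: h_def)
  note uniq = partial_hom_unique[OF gr \<Gamma>(1)]
  have car: "h x \<in> carrier A" if "x \<in> carrier M" for x
    using h[OF that] \<Gamma>(1) subgroup.mem_carrier[of \<Gamma> "M \<times>\<times> A"] by (auto simp: partial_hom_def)
  show thesis
  proof
    show "h \<in> hom M A"
      by (rule homI) (auto simp: car intro: uniq[OF h partial_hom_mult[OF \<Gamma>(1) h h]])
    fix k assume k: "k \<in> carrier K"
    then have "(\<phi> k, \<beta> k) \<in> \<Gamma>" using \<Gamma>(2) by (auto simp: \<Gamma>\<^sub>0_def)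
    then show "h (\<phi> k) = \<beta> k" using uniq h hom_in_carrier[OF \<phi>(1) k] by blast
  qed
qed

section \<open>Linear systems over divisible abelian groups\<close>

text \<open>The rows \<open>r\<^sub>i\<close> are elements of the free abelian group on the variables, and a solution is encoded
  as the homomorphism \<open>h\<close> that extends the assignment of values to the variables. Injectivity of \<open>A\<close>
  is applied to the embedding \<open>frag_extend r\<close> of the free abelian group on \<open>I\<close>.\<close>

lemma divisible_linear_system:
  assumes "comm_group A" "divisible_group A"
    and r: "\<And>i. i \<in> I \<Longrightarrow> r i \<in> carrier (free_Abelian_group X)"
    and indep: "\<And>n. Poly_Mapping.keys n \<subseteq> I \<Longrightarrow> frag_extend r n = 0 \<Longrightarrow> n = 0"
    and b: "\<And>i. i \<in> I \<Longrightarrow> b i \<in> carrier A"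
  obtains h where "h \<in> hom (free_Abelian_group X) A" "\<And>i. i \<in> I \<Longrightarrow> h (r i) = b i"
proof -
  interpret A: comm_group A by fact
  obtain \<beta> where \<beta>: "\<beta> \<in> hom (free_Abelian_group I) A" "\<And>i. i \<in> I \<Longrightarrow> \<beta> (frag_of i) = b i"
    using A.free_Abelian_group_universal[of b I] b by blast
  have "frag_extend r \<in> hom (free_Abelian_group I) (free_Abelian_group X)"
  proof (rule homI)
    fix n assume n: "n \<in> carrier (free_Abelian_group I)"
    have "Poly_Mapping.keys (frag_extend r n) \<subseteq> (\<Union>i\<in>Poly_Mapping.keys n. Poly_Mapping.keys (r i))"
      by (rule keys_frag_extend)
    also have "\<dots> \<subseteq> X" using n r by fastforce
    finally show "frag_extend r n \<in> carrier (free_Abelian_group X)" by simp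
  qed (simp add: frag_extend_add)
  moreover have "inj_on (frag_extend r) (carrier (free_Abelian_group I))"
  proof (rule inj_onI)
    fix m n assume mn: "m \<in> carrier (free_Abelian_group I)" "n \<in> carrier (free_Abelian_group I)"
      and "frag_extend r m = frag_extend r n"
    then have "frag_extend r (m - n) = 0" by (simp add: frag_extend_diff)
    moreover have "Poly_Mapping.keys (m - n) \<subseteq> I"
      using mn keys_diff[of m n] by auto
    ultimately have "m - n = 0" by (intro indep)
    then show "m = n" by simp
  qed
  ultimately obtain h where h: "h \<in> hom (free_Abelian_group X) A"
    "\<And>k. k \<in> carrier (free_Abelian_group I) \<Longrightarrow> h (frag_extend r k) = \<beta> k"
    using divisible_group_injective[OF abelian_free_Abelian_group abelian_free_Abelian_group assms(1,2) _ _ \<beta>(1)]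
    by blast
  show thesis
  proof (rule that[OF h(1)])
    fix i assume "i \<in> I"
    then show "h (r i) = b i" using h(2)[of "frag_of i"] \<beta>(2) by simp
  qed
qed

section \<open>Exponent sums and central corrections\<close>

text \<open>Written as a substitution that kills the coefficients, the row of exponent sums is carried by
  any homomorphism to the corresponding substitution in the target (\<open>hom_word_eval\<close>).\<close>

definition exponent_row :: "'x set \<Rightarrow> ('a, 'x) letter list \<Rightarrow> 'x \<Rightarrow>\<^sub>0 int" where
  "exponent_row X u = word_eval (free_Abelian_group X) (\<lambda>_. 0) frag_of u"

lemma exponent_row_closed:
  "u \<in> free_words G X \<Longrightarrow> exponent_row X u \<in> carrier (free_Abelian_group X)"
proof (induction u)
  case (Cons a u)
  then have u: "exponent_row X u \<in> carrier (free_Abelian_group X)" by (cases a) auto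
  then show ?case
    using Cons.prems monoid.m_closed[OF group.is_monoid[OF group_free_Abelian_group], of _ X "exponent_row X u"]
      group.inv_closed[OF group_free_Abelian_group, of _ X]
    by (cases a) (auto simp: exponent_row_def simp del: mult_free_Abelian_group inv_free_Abelian_group)
qed (simp add: exponent_row_def)

lemma lookup_exponent_row:
  "u \<in> free_words G X \<Longrightarrow> Poly_Mapping.lookup (exponent_row X u) x = word_expsum x u"
proof (induction u)
  case (Cons a u)
  then show ?case
    by (cases a) (auto simp: exponent_row_def lookup_add lookup_minus keys_frag_of)
qed (simp add: exponent_row_def)

lemma hom_word_eval:
  assumes "group H" "group K" "\<theta> \<in> hom H K" "\<psi> \<in> carrier G \<rightarrow> carrier H" "f \<in> X \<rightarrow> carrier H"
    and "\<And>g. g \<in> carrier G \<Longrightarrow> \<psi>' g = \<theta> (\<psi> g)" "\<And>x. x \<in> X \<Longrightarrow> f' x = \<theta> (f x)"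
    and "u \<in> free_words G X"
  shows "word_eval K \<psi>' f' u = \<theta> (word_eval H \<psi> f u) \<and> word_eval H \<psi> f u \<in> carrier H"
proof -
  interpret \<theta>: group_hom H K \<theta>
    using assms by (simp add: group_hom_def group_hom_axioms_def)
  show ?thesis using assms(8)
  proof (induction u)
    case (Cons a u)
    then show ?case using assms(4-7) by (cases a) (auto simp: Pi_iff)
  qed simp
qed

text \<open>Central factors can be moved to the end of the product, past all coefficients. What collects
  there is the word with its coefficients deleted, so it depends on the exponent sums alone.\<close>

lemma word_eval_central_shift:
  assumes "group Q" "subgroup A Q"
    and central: "\<And>a q. a \<in> A \<Longrightarrow> q \<in> carrier Q \<Longrightarrow> a \<otimes>\<^bsub>Q\<^esub> q = q \<otimes>\<^bsub>Q\<^esub> a"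
    and \<phi>: "\<phi> \<in> carrier G \<rightarrow> carrier Q" and f: "f \<in> X \<rightarrow> carrier Q" and z: "z \<in> X \<rightarrow> A"
    and u: "u \<in> free_words G X"
  shows "word_eval Q \<phi> (\<lambda>x. f x \<otimes>\<^bsub>Q\<^esub> z x) u =
      word_eval Q \<phi> f u \<otimes>\<^bsub>Q\<^esub> word_eval Q (\<lambda>_. \<one>\<^bsub>Q\<^esub>) z u
    \<and> word_eval Q \<phi> f u \<in> carrier Q \<and> word_eval Q (\<lambda>_. \<one>\<^bsub>Q\<^esub>) z u \<in> A"
proof -
  interpret group Q by fact
  interpret A: subgroup A Q by fact
  have swap: "(p \<otimes>\<^bsub>Q\<^esub> a) \<otimes>\<^bsub>Q\<^esub> (q \<otimes>\<^bsub>Q\<^esub> b) = (p \<otimes>\<^bsub>Q\<^esub> q) \<otimes>\<^bsub>Q\<^esub> (a \<otimes>\<^bsub>Q\<^esub> b)"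
    if "p \<in> carrier Q" "q \<in> carrier Q" "a \<in> A" "b \<in> A" for p q a b
  proof -
    have "(p \<otimes>\<^bsub>Q\<^esub> a) \<otimes>\<^bsub>Q\<^esub> (q \<otimes>\<^bsub>Q\<^esub> b) = p \<otimes>\<^bsub>Q\<^esub> (a \<otimes>\<^bsub>Q\<^esub> q) \<otimes>\<^bsub>Q\<^esub> b" using that by (simp add: m_assoc)
    then show ?thesis using that by (simp add: central[of a q] m_assoc)
  qed
  have inv_swap: "inv\<^bsub>Q\<^esub> (p \<otimes>\<^bsub>Q\<^esub> a) = inv\<^bsub>Q\<^esub> p \<otimes>\<^bsub>Q\<^esub> inv\<^bsub>Q\<^esub> a"
    if "p \<in> carrier Q" "a \<in> A" for p a
    using that central[of "inv\<^bsub>Q\<^esub> a" "inv\<^bsub>Q\<^esub> p"] by (simp add: inv_mult_group)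
  show ?thesis using u
  proof (induction u)
    case (Cons l u)
    have fz: "f x \<in> carrier Q" "z x \<in> A" if "x \<in> X" for x using that f z by auto
    show ?case
    proof (cases l)
      case (Coeff g)
      then have "\<phi> g \<in> carrier Q" using Cons.prems \<phi> by auto
      then show ?thesis using Cons Coeff by (simp add: m_assoc)
    next
      case (Var x)
      then show ?thesis
        using Cons fz[of x] swap[of "f x" "word_eval Q \<phi> f u" "z x" "word_eval Q (\<lambda>_. \<one>\<^bsub>Q\<^esub>) z u"]
        by simp
    next
      case (VarInv x)
      then show ?thesis
        using Cons fz[of x] inv_swap[of "f x" "z x"]
          swap[of "inv\<^bsub>Q\<^esub> f x" "word_eval Q \<phi> f u" "inv\<^bsub>Q\<^esub> z x" "word_eval Q (\<lambda>_. \<one>\<^bsub>Q\<^esub>) z u"]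
        by simp
    qed
  qed simp
qed

text \<open>The corrected solution is \<open>f \<cdot> z\<close>, where \<open>z\<close> solves the linear system over \<open>A\<close> whose matrix
  consists of the exponent sums and whose right-hand sides are the inverses of the values that \<open>f\<close>
  gives to the \<open>w\<^sub>i\<close>.\<close>

theorem solve_by_central_correction:
  assumes G: "group G" and Q: "group Q" and \<phi>: "\<phi> \<in> hom G Q"
    and A: "subgroup A Q" "divisible_group (Q\<lparr>carrier := A\<rparr>)"
    and central: "\<And>a q. a \<in> A \<Longrightarrow> q \<in> carrier Q \<Longrightarrow> a \<otimes>\<^bsub>Q\<^esub> q = q \<otimes>\<^bsub>Q\<^esub> a"
    and sys: "equation_system G X I w" "nonsingular_system X I w"
    and f: "f \<in> X \<rightarrow> carrier Q" "\<And>i. i \<in> I \<Longrightarrow> ext_lift Q \<phi> f (w i) \<in> A"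
  obtains f' where "f' \<in> X \<rightarrow> carrier Q" "\<And>i. i \<in> I \<Longrightarrow> ext_lift Q \<phi> f' (w i) = \<one>\<^bsub>Q\<^esub>"
proof -
  interpret Q: group Q by fact
  interpret A: subgroup A Q by fact
  let ?A = "Q\<lparr>carrier := A\<rparr>"
  let ?Z = "free_Abelian_group X"
  have gA: "comm_group ?A"
    using A.subgroup_is_group[OF Q] central
    by (intro group.group_comm_groupI) (simp_all)
  have "\<forall>i \<in> I. \<exists>u. u \<in> free_words G X \<and> w i = word_rel G X `` {u}"
    using sys(1) free_ext_carrierE[OF G] unfolding equation_system_def by metis
  then obtain u where u: "\<And>i. i \<in> I \<Longrightarrow> u i \<in> free_words G X"
    and w: "\<And>i. i \<in> I \<Longrightarrow> w i = word_rel G X `` {u i}" by metis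
  have lift: "ext_lift Q \<phi> g (w i) = word_eval Q \<phi> g (u i)" if "i \<in> I" "g \<in> X \<rightarrow> carrier Q" for i g
    using ext_lift_class[OF G Q \<phi> that(2) u] that(1) w by simp
  define r where "r i = exponent_row X (u i)" for i
  have indep: "n = 0" if n: "Poly_Mapping.keys n \<subseteq> I" "frag_extend r n = 0" for n
  proof -
    have "(\<Sum>i \<in> Poly_Mapping.keys n. of_int (Poly_Mapping.lookup n i) * of_int (exponent_sum x (w i))) = (0::rat)" for x
    proof -
      have "0 = Poly_Mapping.lookup (frag_extend r n) x" using n by simp
      also have "\<dots> = (\<Sum>i \<in> Poly_Mapping.keys n. Poly_Mapping.lookup n i * Poly_Mapping.lookup (r i) x)"
        by (simp add: frag_extend_def lookup_sum)
      also have "\<dots> = (\<Sum>i \<in> Poly_Mapping.keys n. Poly_Mapping.lookup n i * exponent_sum x (w i))"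
      proof (rule sum.cong[OF HOL.refl])
        fix i assume "i \<in> Poly_Mapping.keys n"
        then have "i \<in> I" using n by auto
        then show "Poly_Mapping.lookup n i * Poly_Mapping.lookup (r i) x = Poly_Mapping.lookup n i * exponent_sum x (w i)"
          using u w exponent_sum_class[of "u i" G X x] lookup_exponent_row[of "u i" G X x]
          by (simp add: r_def)
      qed
      finally have "of_int 0 = (of_int (\<Sum>i \<in> Poly_Mapping.keys n. Poly_Mapping.lookup n i * exponent_sum x (w i)) :: rat)"
        by (rule arg_cong)
      then show ?thesis by simp
    qed
    then have "\<forall>i \<in> Poly_Mapping.keys n. (of_int (Poly_Mapping.lookup n i) :: rat) = 0"
      using sys(2) n(1) unfolding nonsingular_system_def
      by (elim allE[of _ "Poly_Mapping.keys n"] allE[of _ "\<lambda>i. of_int (Poly_Mapping.lookup n i)"]) simp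
    then show ?thesis by (auto simp: in_keys_iff intro!: poly_mapping_eqI)
  qed
  have val: "word_eval Q \<phi> f (u i) \<in> A" if "i \<in> I" for i using f(2)[OF that] lift[OF that f(1)] by simp
  obtain h where h: "h \<in> hom ?Z ?A" "\<And>i. i \<in> I \<Longrightarrow> h (r i) = inv\<^bsub>Q\<^esub> (word_eval Q \<phi> f (u i))"
    using divisible_linear_system[OF gA A(2), of I r X "\<lambda>i. inv\<^bsub>Q\<^esub> (word_eval Q \<phi> f (u i))"]
      indep val exponent_row_closed[OF u] unfolding r_def by auto
  define z where "z x = h (frag_of x)" for x
  have z: "z \<in> X \<rightarrow> A" using hom_in_carrier[OF h(1)] by (auto simp: z_def)
  have hQ: "h \<in> hom ?Z Q" using h(1) A.subset by (auto simp: hom_def)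
  have "word_eval Q (\<lambda>_. \<one>\<^bsub>Q\<^esub>) z (u i) = h (r i)" if "i \<in> I" for i
    using hom_word_eval[OF group_free_Abelian_group Q hQ _ _ _ _ u[OF that],
        of "\<lambda>_. 0" frag_of "\<lambda>_. \<one>\<^bsub>Q\<^esub>" z]
      hom_one[OF hQ group_free_Abelian_group Q]
    by (simp add: z_def r_def exponent_row_def)
  note wz = this
  let ?f = "\<lambda>x. f x \<otimes>\<^bsub>Q\<^esub> z x"
  have f': "?f \<in> X \<rightarrow> carrier Q" using f(1) z by (auto simp: Pi_iff)
  have \<phi>': "\<phi> \<in> carrier G \<rightarrow> carrier Q" using \<phi> by (simp add: hom_def)
  show thesis
  proof (rule that[OF f'])
    fix i assume i: "i \<in> I"
    have "ext_lift Q \<phi> ?f (w i) = word_eval Q \<phi> f (u i) \<otimes>\<^bsub>Q\<^esub> h (r i)"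
      using word_eval_central_shift[OF Q A(1) central \<phi>' f(1) z u[OF i]] lift[OF i f'] wz[OF i] by simp
    then show "ext_lift Q \<phi> ?f (w i) = \<one>\<^bsub>Q\<^esub>" using h(2)[OF i] val[OF i] by simp
  qed
qed

section \<open>The factors of the lower central series\<close>

definition commutator :: "('a, 'b) monoid_scheme \<Rightarrow> 'a \<Rightarrow> 'a \<Rightarrow> 'a" where
  "commutator G h g = h \<otimes>\<^bsub>G\<^esub> g \<otimes>\<^bsub>G\<^esub> inv\<^bsub>G\<^esub> h \<otimes>\<^bsub>G\<^esub> inv\<^bsub>G\<^esub> g"

lemma lower_central_Suc:
  "lower_central G (Suc k) = generate G {commutator G h g |h g. h \<in> lower_central G k \<and> g \<in> carrier G}"
  by (auto simp: commutator_def intro!: arg_cong[where f = "generate G"])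

lemma (in group) commutator_closed:
  "h \<in> carrier G \<Longrightarrow> g \<in> carrier G \<Longrightarrow> commutator G h g \<in> carrier G"
  by (simp add: commutator_def)

lemma (in group) commutator_eq_one_iff:
  assumes "h \<in> carrier G" "g \<in> carrier G"
  shows "commutator G h g = \<one> \<longleftrightarrow> h \<otimes> g = g \<otimes> h"
proof -
  have "commutator G h g = (h \<otimes> g) \<otimes> inv (g \<otimes> h)"
    using assms by (simp add: commutator_def m_assoc inv_mult_group)
  moreover have "a \<otimes> inv b = \<one> \<longleftrightarrow> a = b" if "a \<in> carrier G" "b \<in> carrier G" for a b
    using that by (metis inv_closed inv_equality inv_inv r_inv)
  ultimately show ?thesis using assms by simp
qed

lemma commutator_hom:
  assumes "group G" "group H" "\<theta> \<in> hom G H" "h \<in> carrier G" "g \<in> carrier G"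
  shows "\<theta> (commutator G h g) = commutator H (\<theta> h) (\<theta> g)"
proof -
  interpret group_hom G H \<theta> using assms by (simp add: group_hom_def group_hom_axioms_def)
  show ?thesis using assms by (simp add: commutator_def)
qed

text \<open>In general \<open>[h, ab] = [h, a] \<cdot> a[h, b]a\<^sup>-\<^sup>1\<close>, and conjugation fixes a central \<open>[h, b]\<close>.\<close>

lemma (in group) commutator_mult_central:
  assumes "h \<in> carrier G" "a \<in> carrier G" "b \<in> carrier G"
    and central: "\<And>q. q \<in> carrier G \<Longrightarrow> commutator G h b \<otimes> q = q \<otimes> commutator G h b"
  shows "commutator G h (a \<otimes> b) = commutator G h a \<otimes> commutator G h b"
proof -
  let ?c = "commutator G h b"
  have c: "?c \<in> carrier G" using assms by (simp add: commutator_closed)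
  have "commutator G h (a \<otimes> b) = h \<otimes> a \<otimes> inv h \<otimes> (?c \<otimes> inv a)"
    using assms(1-3) by (simp add: commutator_def m_assoc inv_mult_group inv_solve_left)
  also have "?c \<otimes> inv a = inv a \<otimes> ?c" using assms by simp
  also have "h \<otimes> a \<otimes> inv h \<otimes> (inv a \<otimes> ?c) = commutator G h a \<otimes> ?c"
    using assms c by (simp add: commutator_def[of _ h a] m_assoc)
  finally show ?thesis .
qed

lemma (in group) commutator_pow_central:
  fixes n :: nat
  assumes "h \<in> carrier G" "g \<in> carrier G"
    and central: "\<And>a q. a \<in> carrier G \<Longrightarrow> q \<in> carrier G \<Longrightarrow>
      commutator G h a \<otimes> q = q \<otimes> commutator G h a"
  shows "commutator G h (g [^] n) = commutator G h g [^] n"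
proof (induction n)
  case 0
  then show ?case using assms by (simp add: commutator_eq_one_iff)
next
  case (Suc n)
  then show ?case using assms commutator_mult_central[of h "g [^] n" g] by simp
qed

lemma (in group) lower_central_normal: "lower_central G k \<lhd> G"
proof (induction k)
  case 0
  show ?case by (simp add: normal_self)
next
  case (Suc k)
  let ?C = "{commutator G h g |h g. h \<in> lower_central G k \<and> g \<in> carrier G}"
  interpret N: normal "lower_central G k" G by (rule Suc)
  have "generate G ?C \<lhd> G"
  proof (rule normal_generateI)
    show "?C \<subseteq> carrier G" by (auto intro: commutator_closed)
    fix c q assume "c \<in> ?C" and q: "q \<in> carrier G"
    then obtain h g where hg: "c = commutator G h g" "h \<in> lower_central G k" "g \<in> carrier G"
      by blast
    define \<theta> where "\<theta> y = q \<otimes> y \<otimes> inv q" for y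
    have "\<theta> \<in> hom G G"
      using q by (auto simp: hom_def \<theta>_def m_assoc inv_solve_left)
    then have "\<theta> c = commutator G (\<theta> h) (\<theta> g)"
      using hg by (simp add: commutator_hom is_group)
    moreover have "\<theta> h \<in> lower_central G k" "\<theta> g \<in> carrier G"
      using N.inv_op_closed2[OF q hg(2)] q hg(3) by (simp_all add: \<theta>_def)
    ultimately show "q \<otimes> c \<otimes> inv q \<in> ?C" unfolding \<theta>_def by blast
  qed
  then show ?case by (simp only: lower_central_Suc)
qed

lemma (in group) lower_central_subset: "lower_central G k \<subseteq> carrier G"
  by (rule subgroup.subset[OF normal_imp_subgroup[OF lower_central_normal]])

lemma commutator_in_lower_central:
  "h \<in> lower_central G k \<Longrightarrow> g \<in> carrier G \<Longrightarrow> commutator G h g \<in> lower_central G (Suc k)"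
  unfolding lower_central_Suc by (rule generate.incl) blast

lemma (in normal) coset_eq_one_iff: "x \<in> carrier G \<Longrightarrow> H #> x = \<one>\<^bsub>G Mod H\<^esub> \<longleftrightarrow> x \<in> H"
  by (metis coset_join1 coset_join2 is_group one_FactGroup subgroup_axioms)

lemma (in group) lower_central_quotient_central:
  assumes "h \<in> lower_central G k" "q \<in> carrier (G Mod lower_central G (Suc k))"
  shows "(lower_central G (Suc k) #> h) \<otimes>\<^bsub>G Mod lower_central G (Suc k)\<^esub> q =
    q \<otimes>\<^bsub>G Mod lower_central G (Suc k)\<^esub> (lower_central G (Suc k) #> h)"
proof -
  let ?N = "lower_central G (Suc k)"
  interpret N: normal ?N G by (rule lower_central_normal)
  interpret Q: group "G Mod ?N" by (rule N.factorgroup_is_group)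
  have h: "h \<in> carrier G"
    using assms(1) lower_central_subset by blast
  obtain g where g: "g \<in> carrier G" "q = ?N #> g" using assms(2) by (auto simp: carrier_FactGroup)
  note \<pi> = N.r_coset_hom_Mod
  have car: "?N #> h \<in> carrier (G Mod ?N)" "?N #> g \<in> carrier (G Mod ?N)"
    using h g by (auto simp only: carrier_FactGroup)
  have "commutator (G Mod ?N) (?N #> h) (?N #> g) = ?N #> commutator G h g"
    using commutator_hom[OF is_group Q.is_group \<pi> h g(1)] by simp
  also have "\<dots> = \<one>\<^bsub>G Mod ?N\<^esub>"
    using N.coset_eq_one_iff h g commutator_in_lower_central[OF assms(1) g(1)]
    by (simp only: commutator_closed)
  finally show ?thesis using Q.commutator_eq_one_iff[OF car] g(2) by simp
qed

text \<open>For \<open>k = 0\<close> a root exists already in \<open>G\<close>. For \<open>k > 0\<close> the generating commutators have roots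
  because a root can be taken in their second entry; as the factor is abelian, roots of products
  and inverses follow.\<close>

lemma (in group) lower_central_quotient_divisible:
  fixes n :: nat
  assumes "divisible_group G" "n > 0" "x \<in> lower_central G k"
  shows "\<exists>y \<in> lower_central G k.
    (lower_central G (Suc k) #> y) [^]\<^bsub>G Mod lower_central G (Suc k)\<^esub> n = lower_central G (Suc k) #> x"
proof -
  let ?N = "lower_central G (Suc k)"
  let ?Q = "G Mod ?N"
  interpret N: normal ?N G by (rule lower_central_normal)
  interpret Q: group ?Q by (rule N.factorgroup_is_group)
  interpret \<pi>: group_hom G ?Q "\<lambda>x. ?N #> x"
    using N.r_coset_hom_Mod by unfold_locales
  show ?thesis
  proof (cases k)
    case 0
    obtain y where "y \<in> carrier G" "y [^] n = x"
      using divisible_group_root assms 0 by (metis lower_central.simps(1))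
    then show ?thesis using 0 \<pi>.hom_nat_pow[of y n] by (intro bexI[of _ y]) simp_all
  next
    case (Suc j)
    interpret L: normal "lower_central G k" G by (rule lower_central_normal)
    have central: "(?N #> a) \<otimes>\<^bsub>?Q\<^esub> q = q \<otimes>\<^bsub>?Q\<^esub> (?N #> a)"
      if "a \<in> lower_central G k" "q \<in> carrier ?Q" for a q
      by (rule lower_central_quotient_central[OF that])
    have "x \<in> generate G {commutator G h g |h g. h \<in> lower_central G j \<and> g \<in> carrier G}"
      using assms(3) Suc lower_central_Suc by metis
    then show ?thesis
    proof induction
      case one
      show ?case using L.one_closed \<pi>.hom_one Q.nat_pow_one by metis
    next
      have root: "\<exists>y \<in> lower_central G k. (?N #> y) [^]\<^bsub>?Q\<^esub> n = ?N #> c"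
        if "c \<in> {commutator G h g |h g. h \<in> lower_central G j \<and> g \<in> carrier G}" for c
      proof -
        obtain h g where hg: "c = commutator G h g" "h \<in> lower_central G j" "g \<in> carrier G"
          using \<open>c \<in> _\<close> by blast
        have h: "h \<in> carrier G"
          using hg(2) lower_central_subset by blast
        obtain g' where g': "g' \<in> carrier G" "g' [^] n = g"
          using divisible_group_root assms(1,2) hg(3) by metis
        have \<pi>c: "?N #> commutator G h a = commutator ?Q (?N #> h) (?N #> a)" if "a \<in> carrier G" for a
          using commutator_hom[OF is_group Q.is_group N.r_coset_hom_Mod h that] .
        have ck: "commutator G h a \<in> lower_central G k" if "a \<in> carrier G" for a
          unfolding Suc by (rule commutator_in_lower_central[OF hg(2) that])
        have "?N #> c = commutator ?Q (?N #> h) ((?N #> g') [^]\<^bsub>?Q\<^esub> n)"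
          using \<pi>c[OF hg(3)] hg(1) g' \<pi>.hom_nat_pow[of g' n] by simp
        also have "\<dots> = commutator ?Q (?N #> h) (?N #> g') [^]\<^bsub>?Q\<^esub> n"
        proof (rule Q.commutator_pow_central)
          fix a q assume a: "a \<in> carrier ?Q" and q: "q \<in> carrier ?Q"
          obtain a' where a': "a' \<in> carrier G" "a = ?N #> a'" using a by (auto simp only: carrier_FactGroup)
          show "commutator ?Q (?N #> h) a \<otimes>\<^bsub>?Q\<^esub> q = q \<otimes>\<^bsub>?Q\<^esub> commutator ?Q (?N #> h) a"
            using central[OF ck[OF a'(1)] q] \<pi>c[OF a'(1)] a'(2) by simp
        qed (use h g' \<pi>.hom_closed in simp_all)
        also have "\<dots> = (?N #> commutator G h g') [^]\<^bsub>?Q\<^esub> n" using \<pi>c[OF g'(1)] by simp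
        finally show ?thesis using ck[OF g'(1)] by metis
      qed
      {
        case (incl c)
        then show ?case by (rule root)
      next
        case (inv c)
        then obtain y where y: "y \<in> lower_central G k" "(?N #> y) [^]\<^bsub>?Q\<^esub> n = ?N #> c"
          using root by blast
        have "c \<in> carrier G"
          using inv lower_central_subset by (auto intro!: commutator_closed)
        then have "(?N #> inv y) [^]\<^bsub>?Q\<^esub> n = ?N #> inv c"
          using y L.subset by (auto simp: \<pi>.hom_inv Q.nat_pow_inv simp del: lower_central.simps)
        then show ?case using L.m_inv_closed[OF y(1)] by blast
      }
    next
      case (eng a b)
      then obtain y z where y: "y \<in> lower_central G k" "(?N #> y) [^]\<^bsub>?Q\<^esub> n = ?N #> a"
        and z: "z \<in> lower_central G k" "(?N #> z) [^]\<^bsub>?Q\<^esub> n = ?N #> b" by blast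
      have C: "{commutator G h g |h g. h \<in> lower_central G j \<and> g \<in> carrier G} \<subseteq> carrier G"
        using lower_central_subset by (auto intro!: commutator_closed)
      have ab: "a \<in> carrier G" "b \<in> carrier G"
        using eng generate_in_carrier[OF C] by blast+
      have yz: "y \<in> carrier G" "z \<in> carrier G" using y z L.subset by auto
      have "(?N #> (y \<otimes> z)) [^]\<^bsub>?Q\<^esub> n = ((?N #> y) \<otimes>\<^bsub>?Q\<^esub> (?N #> z)) [^]\<^bsub>?Q\<^esub> n"
        using yz by (simp only: \<pi>.hom_mult)
      also have "\<dots> = (?N #> y) [^]\<^bsub>?Q\<^esub> n \<otimes>\<^bsub>?Q\<^esub> (?N #> z) [^]\<^bsub>?Q\<^esub> n"
        using yz \<pi>.hom_closed by (intro Q.pow_mult_distrib central[OF y(1)]) simp_all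
      also have "\<dots> = ?N #> (a \<otimes> b)" using y(2) z(2) ab by (simp only: \<pi>.hom_mult)
      finally show ?case using L.m_closed[OF y(1) z(1)] by blast
    qed
  qed
qed

section \<open>Solving along the lower central series\<close>

text \<open>The trivial substitution starts the induction. A step lifts the correction found in
  \<open>G / \<gamma>\<^sub>k\<^sub>+\<^sub>1\<close> back to \<open>G\<close>, where it is a solution up to elements of \<open>\<gamma>\<^sub>k\<^sub>+\<^sub>1\<close>.\<close>

lemma (in group) solvable_modulo_lower_central:
  assumes "divisible_group G"
    and sys: "equation_system G X I w" "nonsingular_system X I w"
  shows "\<exists>f \<in> X \<rightarrow> carrier G. \<forall>i \<in> I. substitute G f (w i) \<in> lower_central G k"
proof (induction k)
  have id: "(\<lambda>g. g) \<in> hom G G" by (simp add: hom_def)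
  {
    case 0
    have f: "(\<lambda>x. \<one>) \<in> X \<rightarrow> carrier G" by simp
    have "substitute G (\<lambda>x. \<one>) (w i) \<in> carrier G" if "i \<in> I" for i
      using hom_in_carrier[OF ext_lift_hom(1)[OF is_group is_group id f]] sys(1) that
      by (simp add: substitute_def equation_system_def)
    then show ?case using f by auto
  next
    case (Suc k)
    let ?L = "lower_central G k" and ?N = "lower_central G (Suc k)"
    let ?Q = "G Mod ?N"
    let ?\<pi> = "\<lambda>x. ?N #> x"
    interpret L: normal ?L G by (rule lower_central_normal)
    interpret N: normal ?N G by (rule lower_central_normal)
    interpret Q: group ?Q by (rule N.factorgroup_is_group)
    interpret \<pi>: group_hom G ?Q ?\<pi> using N.r_coset_hom_Mod by unfold_locales
    have lift: "ext_lift ?Q ?\<pi> f' (w i) = ?\<pi> (substitute G f (w i)) \<and> substitute G f (w i) \<in> carrier G"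
      if f: "f \<in> X \<rightarrow> carrier G" and f': "\<And>x. x \<in> X \<Longrightarrow> f' x = ?\<pi> (f x)" and i: "i \<in> I" for f f' i
    proof -
      obtain u where u: "u \<in> free_words G X" "w i = word_rel G X `` {u}"
        using sys(1) i free_ext_carrierE[OF is_group] unfolding equation_system_def by metis
      have "f' \<in> X \<rightarrow> carrier ?Q"
        using f f' \<pi>.hom_closed by (auto simp only: Pi_iff)
      from ext_lift_class[OF is_group Q.is_group N.r_coset_hom_Mod this u(1)]
        ext_lift_class[OF is_group is_group id f u(1)]
        hom_word_eval[OF is_group Q.is_group N.r_coset_hom_Mod _ f _ f' u(1), of "\<lambda>g. g" ?\<pi>]
      show ?thesis unfolding substitute_def u(2) by simp
    qed
    obtain f where f: "f \<in> X \<rightarrow> carrier G" "\<And>i. i \<in> I \<Longrightarrow> substitute G f (w i) \<in> ?L"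
      using Suc by blast
    let ?A = "?\<pi> ` ?L"
    have A: "subgroup ?A ?Q" by (rule \<pi>.subgroup_img_is_subgroup[OF L.subgroup_axioms])
    have div: "divisible_group (?Q\<lparr>carrier := ?A\<rparr>)"
      unfolding divisible_group_def
    proof (intro conjI allI impI ballI)
      show "group (?Q\<lparr>carrier := ?A\<rparr>)" by (rule Q.subgroup_imp_group[OF A])
      fix p :: nat and a assume p: "prime p" and "a \<in> carrier (?Q\<lparr>carrier := ?A\<rparr>)"
      then obtain x where x: "x \<in> ?L" "a = ?\<pi> x" by auto
      obtain y where "y \<in> ?L" "?\<pi> y [^]\<^bsub>?Q\<^esub> p = a"
        using lower_central_quotient_divisible[OF assms(1) prime_gt_0_nat[OF p] x(1)] x(2) by blast
      then show "\<exists>b \<in> carrier (?Q\<lparr>carrier := ?A\<rparr>). b [^]\<^bsub>?Q\<lparr>carrier := ?A\<rparr>\<^esub> p = a"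
        by (intro bexI[of _ "?\<pi> y"]) (simp_all del: lower_central.simps flip: Q.nat_pow_consistent)
    qed
    have fQ: "(\<lambda>x. ?\<pi> (f x)) \<in> X \<rightarrow> carrier ?Q"
      using f(1) \<pi>.hom_closed by (auto simp only: Pi_iff)
    obtain f' where f': "f' \<in> X \<rightarrow> carrier ?Q" "\<And>i. i \<in> I \<Longrightarrow> ext_lift ?Q ?\<pi> f' (w i) = \<one>\<^bsub>?Q\<^esub>"
    proof (rule solve_by_central_correction[OF is_group Q.is_group N.r_coset_hom_Mod A div _ sys fQ])
      show "a \<otimes>\<^bsub>?Q\<^esub> q = q \<otimes>\<^bsub>?Q\<^esub> a" if "a \<in> ?A" "q \<in> carrier ?Q" for a q
        using that lower_central_quotient_central by blast
      show "ext_lift ?Q ?\<pi> (\<lambda>x. ?\<pi> (f x)) (w i) \<in> ?A" if "i \<in> I" for i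
        using lift[OF f(1) HOL.refl that] f(2)[OF that] by blast
    qed blast
    have "\<forall>x \<in> X. \<exists>g. g \<in> carrier G \<and> f' x = ?\<pi> g"
      using f'(1) unfolding Pi_iff carrier_FactGroup by blast
    then obtain g where g: "\<And>x. x \<in> X \<Longrightarrow> g x \<in> carrier G" "\<And>x. x \<in> X \<Longrightarrow> f' x = ?\<pi> (g x)"
      by metis
    have gX: "g \<in> X \<rightarrow> carrier G" using g(1) by simp
    have "substitute G g (w i) \<in> ?N" if i: "i \<in> I" for i
      using lift[OF gX g(2) i] f'(2)[OF i] N.coset_eq_one_iff by metis
    then show ?case using gX by blast
  }
qed

theorem theorem3:
  fixes G :: "('a, 'b) monoid_scheme"
    and X :: "'x set" and I :: "'i set"
    and w :: "'i \<Rightarrow> ('a, 'x) letter list set"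
  assumes "group G"
    and "divisible_group G"
    and "nilpotent_group G"
    and "equation_system G X I w"
    and "nonsingular_system X I w"
  shows "solvable_system G X I w"
proof -
  obtain c where "lower_central G c = {\<one>\<^bsub>G\<^esub>}" using assms(3) by (auto simp: nilpotent_group_def)
  then show ?thesis
    using group.solvable_modulo_lower_central[OF assms(1,2,4,5), of c] by (simp add: solvable_system_def)
qed

end
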